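(* Let $\mathcal S$ be a finite simplicial poset of rank $n$ with $m$ vertices, and let $\mathcal Z_{\mathcal S}$ be its moment-angle complex. Then $\operatorname{trk}\mathcal Z_{\mathcal S}=m-n$.
   Context: Simplicial posets. A finite poset $\mathcal S$ is simplicial if it has an initial element $\hat 0$ and for each $\sigma\in\mathcal S$ the lower segment $[\hat 0,\sigma]$ is a boolean lattice (the face poset of a simplex). The rank $|\sigma|$ equals $k$ if $[\hat 0,\sigma]$ is the face poset of a $(k-1)$-dimensional simplex; the rank of $\mathcal S$ is the maximum of the ranks of its elements. Vertices are the elements of rank one, identified with $[m]=\{1,\ldots,m\}$. Moment-angle complex. Let $D^2\subset\mathbb C$ be the closed unit disc. For $\sigma\in\mathcal S$ let $B_\sigma=\{(z_1,\ldots,z_m)\in(D^2)^m: |z_j|=1\text{ if }j\not\le\sigma\}$; then $B_\tau\subset B_\sigma$ when $\tau\le\sigma$. $\mathcal Z_{\mathcal S}$ is the colimit in topological spaces of the diagram $\sigma\mapsto B_\sigma$ of these inclusions, indexed by the poset $\mathcal S$ viewed as a category (one morphism $\tau\to\sigma$ whenever $\tau\le\sigma$). The coordinatewise action of $T^m=(S^1)^m$ on $(D^2)^m$ preserves each $B_\sigma$ and induces a $T^m$-action on $\mathcal Z_{\mathcal S}$. An action is almost free if all its isotropy subgroups are finite. The toral rank $\operatorname{trk}\mathcal Z_{\mathcal S}$ is the maximal dimension of a subtorus $T^k\subset T^m$ acting almost freely on $\mathcal Z_{\mathcal S}$. *)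

theory Defs
  imports "HOL-Analysis.Analysis" "HOL-Algebra.Product_Groups" "HOL-Algebra.Group_Action"
begin

section \<open>Simplicial posets\<close>

text \<open>A poset is given by a carrier set \<open>S\<close> and a relation \<open>leq\<close>, of which only the restriction
  to \<open>S\<close> matters.\<close>

text \<open>When \<open>S\<close> has an initial element \<open>0\<close>, this is the interval \<open>[0, \<sigma>]\<close>.\<close>
definition lower_segment :: "'a set \<Rightarrow> ('a \<Rightarrow> 'a \<Rightarrow> bool) \<Rightarrow> 'a \<Rightarrow> 'a set" where
  "lower_segment S leq \<sigma> = {\<tau> \<in> S. leq \<tau> \<sigma>}"

text \<open>The face poset (empty face included) of a simplex with \<open>k\<close> vertices is the set of
  subsets of \<open>{..<k}\<close> ordered by inclusion.\<close>
definition is_simplex_face_poset :: "nat \<Rightarrow> 'a set \<Rightarrow> ('a \<Rightarrow> 'a \<Rightarrow> bool) \<Rightarrow> bool" where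
  "is_simplex_face_poset k P leq \<longleftrightarrow>
     (\<exists>f. bij_betw f P (Pow {..<k}) \<and> (\<forall>x\<in>P. \<forall>y\<in>P. leq x y \<longleftrightarrow> f x \<subseteq> f y))"

definition simplicial_poset :: "'a set \<Rightarrow> ('a \<Rightarrow> 'a \<Rightarrow> bool) \<Rightarrow> bool" where
  "simplicial_poset S leq \<longleftrightarrow>
     reflp_on S leq \<and> antisymp_on S leq \<and> transp_on S leq \<and>
     (\<exists>b\<in>S. \<forall>x\<in>S. leq b x) \<and>
     (\<forall>\<sigma>\<in>S. \<exists>k. is_simplex_face_poset k (lower_segment S leq \<sigma>) leq)"

definition rank_of :: "'a set \<Rightarrow> ('a \<Rightarrow> 'a \<Rightarrow> bool) \<Rightarrow> 'a \<Rightarrow> nat" where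
  "rank_of S leq \<sigma> = (THE k. is_simplex_face_poset k (lower_segment S leq \<sigma>) leq)"

definition poset_rank :: "'a set \<Rightarrow> ('a \<Rightarrow> 'a \<Rightarrow> bool) \<Rightarrow> nat" where
  "poset_rank S leq = Max (rank_of S leq ` S)"

definition vertices :: "'a set \<Rightarrow> ('a \<Rightarrow> 'a \<Rightarrow> bool) \<Rightarrow> 'a set" where
  "vertices S leq = {v \<in> S. rank_of S leq v = 1}"

lemma is_simplex_face_poset_unique:
  assumes "is_simplex_face_poset k P leq" "is_simplex_face_poset l P leq"
  shows "k = l"
proof -
  have "card P = 2 ^ i" if "is_simplex_face_poset i P leq" for i
    using that bij_betw_same_card by (fastforce simp: is_simplex_face_poset_def card_Pow)
  then have "(2::nat) ^ k = 2 ^ l"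
    using assms by metis
  then show ?thesis by simp
qed

lemma rank_of_eq:
  "is_simplex_face_poset k (lower_segment S leq \<sigma>) leq \<Longrightarrow> rank_of S leq \<sigma> = k"
  unfolding rank_of_def using is_simplex_face_poset_unique by blast

lemma rank_of_simplicial_poset:
  assumes "simplicial_poset S leq" "\<sigma> \<in> S"
  shows "is_simplex_face_poset (rank_of S leq \<sigma>) (lower_segment S leq \<sigma>) leq"
  using assms rank_of_eq unfolding simplicial_poset_def by metis


section \<open>Tori\<close>

text \<open>The torus with coordinates indexed by \<open>I\<close>: functions on \<open>I\<close> that are \<open>undefined\<close> elsewhere.\<close>

definition circle_group :: "complex monoid" where
  "circle_group = \<lparr>carrier = sphere 0 1, monoid.mult = (*), one = 1\<rparr>"

definition torus_group :: "'i set \<Rightarrow> ('i \<Rightarrow> complex) monoid" where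
  "torus_group I = product_group I (\<lambda>_. circle_group)"

definition torus_top :: "'i set \<Rightarrow> ('i \<Rightarrow> complex) topology" where
  "torus_top I = product_topology (\<lambda>_. top_of_set (sphere 0 1)) I"

text \<open>\<open>H\<close> is a \<open>k\<close>-dimensional subtorus: a subgroup isomorphic, as a topological group, to the
  standard \<open>k\<close>-dimensional torus.\<close>
definition is_subtorus :: "'i set \<Rightarrow> nat \<Rightarrow> ('i \<Rightarrow> complex) set \<Rightarrow> bool" where
  "is_subtorus I k H \<longleftrightarrow>
     subgroup H (torus_group I) \<and>
     (\<exists>f. f \<in> iso (torus_group {..<k}) ((torus_group I)\<lparr>carrier := H\<rparr>) \<and>
          homeomorphic_map (torus_top {..<k}) (subtopology (torus_top I) H) f)"


section \<open>The moment-angle complex\<close>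

text \<open>Coordinates are indexed by the vertices themselves.\<close>

definition disc_block :: "'a set \<Rightarrow> ('a \<Rightarrow> 'a \<Rightarrow> bool) \<Rightarrow> 'a \<Rightarrow> ('a \<Rightarrow> complex) set" where
  "disc_block S leq \<sigma> =
     {z \<in> vertices S leq \<rightarrow>\<^sub>E cball 0 1. \<forall>j\<in>vertices S leq. \<not> leq j \<sigma> \<longrightarrow> cmod (z j) = 1}"

definition disc_block_top :: "'a set \<Rightarrow> ('a \<Rightarrow> 'a \<Rightarrow> bool) \<Rightarrow> 'a \<Rightarrow> ('a \<Rightarrow> complex) topology" where
  "disc_block_top S leq \<sigma> =
     subtopology (product_topology (\<lambda>_. top_of_set (cball 0 1)) (vertices S leq)) (disc_block S leq \<sigma>)"

text \<open>The colimit of \<open>\<sigma> \<mapsto> disc_block S leq \<sigma>\<close> is constructed in the standard way: the quotient of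
  the topological coproduct by the equivalence relation generated by identifying each point of a
  block with its images under the inclusions of the diagram.\<close>

definition block_coproduct ::
    "'a set \<Rightarrow> ('a \<Rightarrow> 'a \<Rightarrow> bool) \<Rightarrow> ('a \<times> ('a \<Rightarrow> complex)) topology" where
  "block_coproduct S leq = sum_topology (disc_block_top S leq) S"

definition glue ::
    "'a set \<Rightarrow> ('a \<Rightarrow> 'a \<Rightarrow> bool) \<Rightarrow> (('a \<times> ('a \<Rightarrow> complex)) \<times> ('a \<times> ('a \<Rightarrow> complex))) set" where
  "glue S leq = {((\<tau>, z), (\<sigma>, z)) | \<tau> \<sigma> z. \<tau> \<in> S \<and> \<sigma> \<in> S \<and> leq \<tau> \<sigma> \<and> z \<in> disc_block S leq \<tau>}"

definition glue_equiv ::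
    "'a set \<Rightarrow> ('a \<Rightarrow> 'a \<Rightarrow> bool) \<Rightarrow> (('a \<times> ('a \<Rightarrow> complex)) \<times> ('a \<times> ('a \<Rightarrow> complex))) set" where
  "glue_equiv S leq = (glue S leq \<union> (glue S leq)\<inverse>)\<^sup>*"

definition glue_class ::
    "'a set \<Rightarrow> ('a \<Rightarrow> 'a \<Rightarrow> bool) \<Rightarrow> 'a \<times> ('a \<Rightarrow> complex) \<Rightarrow> ('a \<times> ('a \<Rightarrow> complex)) set" where
  "glue_class S leq x = glue_equiv S leq `` {x}"

definition moment_angle_complex ::
    "'a set \<Rightarrow> ('a \<Rightarrow> 'a \<Rightarrow> bool) \<Rightarrow> ('a \<times> ('a \<Rightarrow> complex)) set topology" where
  "moment_angle_complex S leq = topology (\<lambda>U.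
     U \<subseteq> topspace (block_coproduct S leq) // glue_equiv S leq \<and>
     openin (block_coproduct S leq)
       {x \<in> topspace (block_coproduct S leq). glue_class S leq x \<in> U})"

text \<open>An element of the torus acts on a point of the quotient, which is an equivalence class, by
  moving all representatives coordinatewise inside their blocks; see \<open>torus_action_class\<close> below.\<close>

definition block_act ::
    "'a set \<Rightarrow> ('a \<Rightarrow> 'a \<Rightarrow> bool) \<Rightarrow> ('a \<Rightarrow> complex) \<Rightarrow> 'a \<times> ('a \<Rightarrow> complex) \<Rightarrow> 'a \<times> ('a \<Rightarrow> complex)" where
  "block_act S leq t = (\<lambda>(\<sigma>, z). (\<sigma>, \<lambda>j\<in>vertices S leq. t j * z j))"

definition torus_action ::
    "'a set \<Rightarrow> ('a \<Rightarrow> 'a \<Rightarrow> bool) \<Rightarrow> ('a \<Rightarrow> complex) \<Rightarrow>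
     ('a \<times> ('a \<Rightarrow> complex)) set \<Rightarrow> ('a \<times> ('a \<Rightarrow> complex)) set" where
  "torus_action S leq t = (\<lambda>p\<in>topspace (moment_angle_complex S leq). block_act S leq t ` p)"


section \<open>Toral rank\<close>

definition almost_free :: "('g, 'b) monoid_scheme \<Rightarrow> 'x set \<Rightarrow> ('g \<Rightarrow> 'x \<Rightarrow> 'x) \<Rightarrow> bool" where
  "almost_free G E \<phi> \<longleftrightarrow> (\<forall>x\<in>E. finite (stabilizer G \<phi> x))"

definition almost_free_dims :: "'a set \<Rightarrow> ('a \<Rightarrow> 'a \<Rightarrow> bool) \<Rightarrow> nat set" where
  "almost_free_dims S leq =
     {k. \<exists>H. is_subtorus (vertices S leq) k H \<and>
             almost_free ((torus_group (vertices S leq))\<lparr>carrier := H\<rparr>)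
               (topspace (moment_angle_complex S leq)) (torus_action S leq)}"

text \<open>For finite \<open>S\<close> the set is finite and nonempty, so the maximum is meaningful; see
  \<open>toral_rank_greatest\<close> below.\<close>
definition toral_rank :: "'a set \<Rightarrow> ('a \<Rightarrow> 'a \<Rightarrow> bool) \<Rightarrow> nat" where
  "toral_rank S leq = Max (almost_free_dims S leq)"


section \<open>Well-definedness\<close>

lemma carrier_torus_group: "carrier (torus_group I) = I \<rightarrow>\<^sub>E sphere 0 1"
  and mult_torus_group: "s \<otimes>\<^bsub>torus_group I\<^esub> t = (\<lambda>i\<in>I. s i * t i)"
  and one_torus_group: "\<one>\<^bsub>torus_group I\<^esub> = (\<lambda>i\<in>I. 1)"
  by (simp_all add: torus_group_def circle_group_def product_group_def)

lemma topspace_torus_top: "topspace (torus_top I) = carrier (torus_group I)"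
  by (simp add: torus_top_def carrier_torus_group)

lemma group_torus_group: "group (torus_group I)"
proof -
  have "group circle_group"
  proof (rule groupI)
    fix x assume "x \<in> carrier circle_group"
    then show "\<exists>y\<in>carrier circle_group. y \<otimes>\<^bsub>circle_group\<^esub> x = \<one>\<^bsub>circle_group\<^esub>"
      by (intro bexI[of _ "inverse x"]) (auto simp: circle_group_def norm_inverse intro!: left_inverse)
  qed (auto simp: circle_group_def norm_mult)
  then show ?thesis
    unfolding torus_group_def by simp
qed

lemma topspace_block_coproduct: "topspace (block_coproduct S leq) = Sigma S (disc_block S leq)"
  by (auto simp: block_coproduct_def disc_block_top_def disc_block_def)

lemma quotient_map_moment_angle_complex:
  "quotient_map (block_coproduct S leq) (moment_angle_complex S leq) (glue_class S leq)"
proof -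
  let ?X = "block_coproduct S leq" and ?q = "glue_class S leq"
  let ?C = "topspace ?X // glue_equiv S leq"
  let ?P = "\<lambda>U. U \<subseteq> ?C \<and> openin ?X {x \<in> topspace ?X. ?q x \<in> U}"
  have C: "?C = ?q ` topspace ?X"
    by (auto simp: quotient_def glue_class_def)
  have "istopology ?P"
    unfolding istopology_def
  proof (intro conjI allI impI)
    fix U V assume "?P U" "?P V"
    then have "openin ?X ({x \<in> topspace ?X. ?q x \<in> U} \<inter> {x \<in> topspace ?X. ?q x \<in> V})"
      by blast
    also have "\<dots> = {x \<in> topspace ?X. ?q x \<in> U \<inter> V}" by auto
    finally show "openin ?X {x \<in> topspace ?X. ?q x \<in> U \<inter> V}" by (simp add: Int_def)
  next
    fix \<K> assume "\<forall>K\<in>\<K>. ?P K"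
    then have "openin ?X (\<Union>K\<in>\<K>. {x \<in> topspace ?X. ?q x \<in> K})"
      by blast
    also have "(\<Union>K\<in>\<K>. {x \<in> topspace ?X. ?q x \<in> K}) = {x \<in> topspace ?X. ?q x \<in> \<Union>\<K>}" by auto
    finally show "openin ?X {x \<in> topspace ?X. ?q x \<in> \<Union>\<K>}" .
  qed blast+
  then have op: "openin (moment_angle_complex S leq) = ?P"
    by (simp add: moment_angle_complex_def topology_inverse')
  have "{x \<in> topspace ?X. ?q x \<in> ?C} = topspace ?X"
    by (auto simp: C)
  then have "?P ?C" by simp
  then have "topspace (moment_angle_complex S leq) = ?C"
    unfolding topspace_def op by blast
  then show ?thesis
    by (auto simp: quotient_map_def op C)
qed

lemma topspace_moment_angle_complex:
  "topspace (moment_angle_complex S leq) = glue_class S leq ` Sigma S (disc_block S leq)"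
  using quotient_imp_surjective_map[OF quotient_map_moment_angle_complex]
  by (metis topspace_block_coproduct)

lemma block_act_glue_equiv:
  assumes t: "t \<in> carrier (torus_group (vertices S leq))" and "(x, y) \<in> glue_equiv S leq"
  shows "(block_act S leq t x, block_act S leq t y) \<in> glue_equiv S leq"
proof -
  have tn: "cmod (t j) = 1" if "j \<in> vertices S leq" for j
    using t that by (auto simp: carrier_torus_group PiE_iff)
  have blk: "(\<lambda>j\<in>vertices S leq. t j * z j) \<in> disc_block S leq \<sigma>" if "z \<in> disc_block S leq \<sigma>" for z \<sigma>
    using that by (auto simp: disc_block_def norm_mult tn PiE_iff)
  have "(block_act S leq t u, block_act S leq t v) \<in> glue S leq" if "(u, v) \<in> glue S leq" for u v
    using that blk by (auto simp: glue_def block_act_def)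
  then have step: "(block_act S leq t u, block_act S leq t v) \<in> glue_equiv S leq"
    if "(u, v) \<in> glue S leq \<union> (glue S leq)\<inverse>" for u v
    using that unfolding glue_equiv_def by blast
  from assms(2) show ?thesis
    unfolding glue_equiv_def
  proof (induction rule: rtrancl_induct)
    case (step y z)
    then show ?case
      using \<open>\<And>u v. _ \<Longrightarrow> (block_act S leq t u, block_act S leq t v) \<in> glue_equiv S leq\<close>
      unfolding glue_equiv_def by (meson rtrancl_trans)
  qed simp
qed

lemma block_act_Sigma:
  assumes "t \<in> carrier (torus_group (vertices S leq))" "x \<in> Sigma S (disc_block S leq)"
  shows "block_act S leq t x \<in> Sigma S (disc_block S leq)"
  using assms by (auto simp: carrier_torus_group disc_block_def block_act_def norm_mult PiE_iff)

lemma glue_equiv_Sigma: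
  assumes xy: "(x, y) \<in> glue_equiv S leq"
    and x: "x \<in> Sigma S (disc_block S leq)"
    and vS: "vertices S leq \<subseteq> S"
  shows "y \<in> S \<times> (vertices S leq \<rightarrow>\<^sub>E cball 0 1)"
proof -
  have "x \<in> S \<times> (vertices S leq \<rightarrow>\<^sub>E cball 0 1)"
    using x by (cases x) (simp add: disc_block_def)
  with xy show ?thesis
    unfolding glue_equiv_def
    by (induction rule: rtrancl_induct) (auto simp: glue_def disc_block_def)
qed

lemma torus_action_class:
  assumes t: "t \<in> carrier (torus_group (vertices S leq))"
    and x: "x \<in> Sigma S (disc_block S leq)"
  shows "torus_action S leq t (glue_class S leq x) = glue_class S leq (block_act S leq t x)"
proof -
  let ?V = "vertices S leq"
  have VS: "?V \<subseteq> S" by (auto simp: vertices_def)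
  have tn: "cmod (t j) = 1" if "j \<in> ?V" for j
    using t that by (auto simp: carrier_torus_group PiE_iff)
  define t' where "t' = (\<lambda>j\<in>?V. inverse (t j))"
  have t': "t' \<in> carrier (torus_group ?V)"
    by (auto simp: t'_def carrier_torus_group norm_inverse tn)
  have nz: "t j \<noteq> 0" if "j \<in> ?V" for j
    using tn[OF that] by auto
  have inv1: "block_act S leq t' (block_act S leq t y) = y"
    and inv2: "block_act S leq t (block_act S leq t' y) = y" if "y \<in> S \<times> (?V \<rightarrow>\<^sub>E cball 0 1)" for y
    using that nz by (auto simp: block_act_def t'_def fun_eq_iff PiE_iff extensional_def)
  have "block_act S leq t ` glue_class S leq x = glue_class S leq (block_act S leq t x)"
  proof
    show "block_act S leq t ` glue_class S leq x \<subseteq> glue_class S leq (block_act S leq t x)"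
      using block_act_glue_equiv[OF t] by (auto simp: glue_class_def)
    show "glue_class S leq (block_act S leq t x) \<subseteq> block_act S leq t ` glue_class S leq x"
    proof
      fix y assume "y \<in> glue_class S leq (block_act S leq t x)"
      then have xy: "(block_act S leq t x, y) \<in> glue_equiv S leq" by (simp add: glue_class_def)
      have "y \<in> S \<times> (?V \<rightarrow>\<^sub>E cball 0 1)"
        using glue_equiv_Sigma[OF xy block_act_Sigma[OF t x] VS] .
      moreover have "x \<in> S \<times> (?V \<rightarrow>\<^sub>E cball 0 1)"
        using x by (cases x) (simp add: disc_block_def)
      ultimately have "(x, block_act S leq t' y) \<in> glue_equiv S leq"
        "y = block_act S leq t (block_act S leq t' y)"
        using block_act_glue_equiv[OF t' xy] inv1 inv2 by auto
      then show "y \<in> block_act S leq t ` glue_class S leq x"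
        by (auto simp: glue_class_def)
    qed
  qed
  then show ?thesis
    using x by (simp add: torus_action_def topspace_moment_angle_complex)
qed

lemma group_action_torus_action:
  "group_action (torus_group (vertices S leq)) (topspace (moment_angle_complex S leq))
     (torus_action S leq)"
proof -
  let ?G = "torus_group (vertices S leq)" and ?E = "topspace (moment_angle_complex S leq)"
    and ?a = "torus_action S leq"
  interpret G: group ?G by (rule group_torus_group)
  have rep: "\<exists>x \<in> Sigma S (disc_block S leq). p = glue_class S leq x" if "p \<in> ?E" for p
    using that by (auto simp: topspace_moment_angle_complex)
  have clE: "glue_class S leq x \<in> ?E" if "x \<in> Sigma S (disc_block S leq)" for x
    using that by (simp add: topspace_moment_angle_complex)
  have cl: "?a t p \<in> ?E" if "t \<in> carrier ?G" "p \<in> ?E" for t p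
    using rep[OF that(2)] torus_action_class[OF that(1)] block_act_Sigma[OF that(1)] clE by metis
  have bm: "block_act S leq (s \<otimes>\<^bsub>?G\<^esub> t) x = block_act S leq s (block_act S leq t x)" for s t x
    by (cases x) (auto simp: block_act_def mult_torus_group mult.assoc)
  have mult: "?a (s \<otimes>\<^bsub>?G\<^esub> t) p = ?a s (?a t p)"
    if "s \<in> carrier ?G" "t \<in> carrier ?G" "p \<in> ?E" for s t p
  proof -
    obtain x where x: "x \<in> Sigma S (disc_block S leq)" "p = glue_class S leq x"
      using rep[OF \<open>p \<in> ?E\<close>] by blast
    show ?thesis
      unfolding x(2) torus_action_class[OF that(2) x(1)]
        torus_action_class[OF that(1) block_act_Sigma[OF that(2) x(1)]]
        torus_action_class[OF G.m_closed[OF that(1,2)] x(1)] bm ..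
  qed
  have one: "?a \<one>\<^bsub>?G\<^esub> p = p" if p: "p \<in> ?E" for p
  proof -
    obtain x where x: "x \<in> Sigma S (disc_block S leq)" "p = glue_class S leq x"
      using rep[OF p] by blast
    have "block_act S leq \<one>\<^bsub>?G\<^esub> x = x"
      using x(1) by (auto simp: block_act_def one_torus_group disc_block_def fun_eq_iff PiE_iff extensional_def)
    then show ?thesis using x torus_action_class[OF G.one_closed x(1)] by simp
  qed
  have bij: "?a t \<in> Bij ?E" if t: "t \<in> carrier ?G" for t
  proof -
    have "bij_betw (?a t) ?E ?E"
    proof (rule bij_betwI[where g = "?a (inv\<^bsub>?G\<^esub> t)"])
      show "?a t \<in> ?E \<rightarrow> ?E" "?a (inv\<^bsub>?G\<^esub> t) \<in> ?E \<rightarrow> ?E"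
        using t cl by auto
      show "?a (inv\<^bsub>?G\<^esub> t) (?a t p) = p" if "p \<in> ?E" for p
        using mult[of "inv\<^bsub>?G\<^esub> t" t p] one[OF that] t that by simp
      show "?a t (?a (inv\<^bsub>?G\<^esub> t) p) = p" if "p \<in> ?E" for p
        using mult[of t "inv\<^bsub>?G\<^esub> t" p] one[OF that] t that by simp
    qed
    then show ?thesis by (simp add: Bij_def torus_action_def)
  qed
  have "?a (s \<otimes>\<^bsub>?G\<^esub> t) = compose ?E (?a s) (?a t)"
    if "s \<in> carrier ?G" "t \<in> carrier ?G" for s t
  proof
    fix p
    show "?a (s \<otimes>\<^bsub>?G\<^esub> t) p = compose ?E (?a s) (?a t) p"
      using mult[OF that] by (cases "p \<in> ?E") (auto simp: compose_def torus_action_def)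
  qed
  then have "?a \<in> hom ?G (BijGroup ?E)"
    using bij by (auto simp: hom_def BijGroup_def)
  then show ?thesis
    by (simp add: group_action_def group_hom_def group_hom_axioms_def group_BijGroup group_torus_group)
qed

lemma subtorus_dim_le:
  assumes "finite I" "is_subtorus I k H"
  shows "k \<le> card I"
proof -
  obtain f where f: "f \<in> iso (torus_group {..<k}) ((torus_group I)\<lparr>carrier := H\<rparr>)"
    and H: "subgroup H (torus_group I)"
    using assms(2) by (auto simp: is_subtorus_def)
  define B where "B = {..<k} \<rightarrow>\<^sub>E {1, - 1 :: complex}"
  interpret K: group "torus_group {..<k}" by (rule group_torus_group)
  interpret G: group "torus_group I" by (rule group_torus_group)
  have HG: "group ((torus_group I)\<lparr>carrier := H\<rparr>)"
    using H G.subgroup_imp_group by blast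
  have bij: "bij_betw f (carrier (torus_group {..<k})) H"
    and hom: "f \<in> hom (torus_group {..<k}) ((torus_group I)\<lparr>carrier := H\<rparr>)"
    using f by (auto simp: iso_def)
  have f1: "f \<one>\<^bsub>torus_group {..<k}\<^esub> = \<one>\<^bsub>torus_group I\<^esub>"
    using hom_one[OF hom K.group_axioms HG] by simp
  have BC: "B \<subseteq> carrier (torus_group {..<k})"
    unfolding B_def carrier_torus_group by (rule PiE_mono) auto
  have B2: "x \<otimes>\<^bsub>torus_group {..<k}\<^esub> x = \<one>\<^bsub>torus_group {..<k}\<^esub>" if "x \<in> B" for x
    using that unfolding mult_torus_group one_torus_group
    by (intro restrict_ext) (auto simp: B_def PiE_iff square_eq_1_iff)
  have "f ` B \<subseteq> I \<rightarrow>\<^sub>E {1, - 1}"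
  proof (rule image_subsetI)
    fix x assume x: "x \<in> B"
    then have xc: "x \<in> carrier (torus_group {..<k})" using BC by blast
    have "f x \<otimes>\<^bsub>torus_group I\<^esub> f x = f (x \<otimes>\<^bsub>torus_group {..<k}\<^esub> x)"
      using hom_mult[OF hom xc xc] by simp
    also have "\<dots> = \<one>\<^bsub>torus_group I\<^esub>"
      using B2[OF x] f1 by simp
    finally have eq: "(\<lambda>i\<in>I. f x i * f x i) = (\<lambda>i\<in>I. 1)"
      by (simp add: mult_torus_group one_torus_group)
    have "f x i * f x i = 1" if "i \<in> I" for i
      using fun_cong[OF eq, of i] that by simp
    then have sq: "f x i = 1 \<or> f x i = - 1" if "i \<in> I" for i
      using that square_eq_1_iff by blast
    have "f x \<in> carrier (torus_group I)"
      using bij xc subgroup.subset[OF H] bij_betwE by blast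
    then show "f x \<in> I \<rightarrow>\<^sub>E {1, - 1}"
      using sq by (auto simp: carrier_torus_group PiE_iff)
  qed
  moreover have "inj_on f B"
    using bij BC by (meson bij_betw_def inj_on_subset)
  moreover have "finite (I \<rightarrow>\<^sub>E {1, - 1 :: complex})"
    using assms(1) by (intro finite_PiE) auto
  ultimately have "card B \<le> card (I \<rightarrow>\<^sub>E {1, - 1 :: complex})"
    using card_inj_on_le by blast
  moreover have "(1::complex) \<noteq> - 1" by simp
  ultimately have "(2::nat) ^ k \<le> 2 ^ card I"
    using assms(1) by (simp add: B_def card_PiE)
  then show ?thesis by simp
qed

lemma is_subtorus_trivial: "is_subtorus I 0 {\<one>\<^bsub>torus_group I\<^esub>}"
proof -
  interpret G: group "torus_group I" by (rule group_torus_group)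
  let ?f = "\<lambda>_ :: nat \<Rightarrow> complex. \<one>\<^bsub>torus_group I\<^esub>"
  have c: "carrier (torus_group {..<0::nat}) = {\<lambda>_. undefined}"
    by (simp add: carrier_torus_group)
  have "?f \<in> iso (torus_group {..<0}) ((torus_group I)\<lparr>carrier := {\<one>\<^bsub>torus_group I\<^esub>}\<rparr>)"
    using c by (auto simp: iso_def hom_def bij_betw_def)
  moreover have "homeomorphic_map (torus_top {..<0}) (subtopology (torus_top I) {\<one>\<^bsub>torus_group I\<^esub>}) ?f"
  proof (rule bijective_open_imp_homeomorphic_map)
    have 1: "topspace (torus_top {..<0::nat}) = {\<lambda>_. undefined}"
      using c by (simp add: topspace_torus_top)
    have 2: "topspace (subtopology (torus_top I) {\<one>\<^bsub>torus_group I\<^esub>}) = {\<one>\<^bsub>torus_group I\<^esub>}"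
      using G.one_closed by (auto simp: topspace_torus_top)
    show "continuous_map (torus_top {..<0}) (subtopology (torus_top I) {\<one>\<^bsub>torus_group I\<^esub>}) ?f"
      using 2 by (intro continuous_map_const[THEN iffD2]) auto
    show "open_map (torus_top {..<0}) (subtopology (torus_top I) {\<one>\<^bsub>torus_group I\<^esub>}) ?f"
      unfolding open_map_def
    proof (intro allI impI)
      fix U assume "openin (torus_top {..<0::nat}) U"
      have "?f ` U = {} \<or> ?f ` U = topspace (subtopology (torus_top I) {\<one>\<^bsub>torus_group I\<^esub>})"
        unfolding 2 by auto
      then show "openin (subtopology (torus_top I) {\<one>\<^bsub>torus_group I\<^esub>}) (?f ` U)"
        by (metis openin_empty openin_topspace)
    qed
    show "?f ` topspace (torus_top {..<0}) = topspace (subtopology (torus_top I) {\<one>\<^bsub>torus_group I\<^esub>})"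
      unfolding 1 2 by simp
    show "inj_on ?f (topspace (torus_top {..<0}))"
      unfolding 1 by simp
  qed
  ultimately show ?thesis
    unfolding is_subtorus_def using G.triv_subgroup by blast
qed

lemma toral_rank_greatest:
  assumes "finite S"
  shows "toral_rank S leq \<in> almost_free_dims S leq"
    and "k \<in> almost_free_dims S leq \<Longrightarrow> k \<le> toral_rank S leq"
proof -
  have "finite (vertices S leq)"
    using assms by (simp add: vertices_def)
  then have "almost_free_dims S leq \<subseteq> {..card (vertices S leq)}"
    using subtorus_dim_le by (auto simp: almost_free_dims_def)
  then have fin: "finite (almost_free_dims S leq)"
    using finite_subset by blast
  have "0 \<in> almost_free_dims S leq"
    unfolding almost_free_dims_def almost_free_def stabilizer_def
    using is_subtorus_trivial by fastforce
  then show "toral_rank S leq \<in> almost_free_dims S leq"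
    using fin Max_in unfolding toral_rank_def by blast
  show "k \<le> toral_rank S leq" if "k \<in> almost_free_dims S leq"
    using fin that unfolding toral_rank_def by simp
qed

end

theory Submission
  imports Defs "HOL-Computational_Algebra.Polynomial" "HOL-Algebra.Multiplicative_Group"
begin

text \<open>
  Gluing never changes the coordinates \<open>z\<close> of a point, so \<open>t\<close> fixes the class of \<open>(\<sigma>, z)\<close> iff
  \<open>t j = 1\<close> wherever \<open>z j \<noteq> 0\<close>. Inside the block of \<open>\<sigma>\<close> only the coordinates \<open>j \<le> \<sigma>\<close> can vanish, and
  they can all vanish at once. Hence a subgroup \<open>H\<close> acts almost freely iff it meets, for each \<open>\<sigma>\<close>,
  the coordinate torus of the vertices of \<open>\<sigma>\<close> in a finite group (\<open>almost_free_iff\<close>). As \<open>\<sigma>\<close> has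
  \<open>rank \<sigma>\<close> vertices (\<open>card_vertices_below\<close>), the toral rank is decided by how subtori of \<open>T\<^sup>m\<close> meet
  coordinate tori of dimension at most \<open>n\<close>.

  Upper bound: for \<open>\<sigma>\<close> of rank \<open>n\<close>, the projection of \<open>H\<close> to the \<open>m - n\<close> coordinates outside \<open>\<sigma>\<close> has
  finite kernel, and counting torsion points shows \<open>dim H \<le> m - n\<close>
  (\<open>subtorus_dim_le_card_constraints\<close>).

  Lower bound: some \<open>(m - n)\<close>-dimensional subtorus meets every coordinate torus of codimension \<open>m - n\<close>
  in a finite group (\<open>ex_generic_subtorus\<close>). Number the coordinates \<open>x = 0, \<dots>, m - 1\<close> and, with
  \<open>k = m - n\<close>, take all points with coordinates
  \<open>\<Prod>i<k. s i ^ (x choose i)\<close> for \<open>s\<close> in the standard \<open>k\<close>-dimensional torus.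
  The exponents form an \<open>m \<times> k\<close> integer matrix whose first \<open>k\<close> rows are unitriangular, so that the
  parametrisation is an embedding, and in which every \<open>k\<close> rows are linearly independent, because a
  polynomial of degree less than \<open>k\<close> is determined by its values at \<open>k\<close> points. The Vandermonde
  exponents \<open>x\<^sup>i\<close> have the second property but in general not the first.
\<close>

section \<open>Lagrange interpolation and binomial coefficients\<close>

lemma lagrange_interpolation:
  fixes p :: "'f::field poly"
  assumes "finite A" "degree p < card A"
  shows "poly p x = (\<Sum>a\<in>A. poly p a * (\<Prod>b\<in>A-{a}. (x - b) / (a - b)))"
proof -
  define q where
    "q = (\<Sum>a\<in>A. Polynomial.smult (poly p a * (\<Prod>b\<in>A-{a}. 1 / (a - b))) (\<Prod>b\<in>A-{a}. [:- b, 1:]))"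
  have q: "poly q y = (\<Sum>a\<in>A. poly p a * (\<Prod>b\<in>A-{a}. (y - b) / (a - b)))" for y
    by (simp add: q_def poly_sum poly_prod prod_dividef mult.assoc)
  have "p = q"
  proof (rule poly_eqI_degree)
    fix y assume y: "y \<in> A"
    have "(\<Prod>b\<in>A-{a}. (y - b) / (a - b)) = (if a = y then 1 else 0)" if "a \<in> A" for a
      using assms(1) that y by (auto simp: prod_zero_iff intro!: prod.neutral)
    then have "poly q y = (\<Sum>a\<in>A. if a = y then poly p a else 0)"
      unfolding q by (intro sum.cong) auto
    then show "poly p y = poly q y"
      using assms(1) y by simp
  next
    have "degree q \<le> card A - 1"
      unfolding q_def
    proof (rule degree_sum_le)
      fix a assume "a \<in> A"
      have "degree (\<Prod>b\<in>A-{a}. [:- b, 1:]) \<le> (\<Sum>b\<in>A-{a}. degree [:- b, 1:])"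
        using assms(1) by (intro degree_prod_sum_le[unfolded o_def]) auto
      also have "\<dots> = card A - 1"
        using assms(1) \<open>a \<in> A\<close> by simp
      finally show "degree (Polynomial.smult (poly p a * (\<Prod>b\<in>A-{a}. 1 / (a - b))) (\<Prod>b\<in>A-{a}. [:- b, 1:]))
          \<le> card A - 1"
        using degree_smult_le order.trans by blast
    qed (use assms in auto)
    then show "card A > degree q"
      using assms(2) by linarith
  qed (use assms in auto)
  then show ?thesis using q[of x] by metis
qed

text \<open>The binomial coefficient is \<open>x(x - 1)\<dots>(x - i + 1) / i!\<close>.\<close>
lemma ex_binomial_poly:
  "\<exists>p :: real poly. degree p \<le> i \<and> (\<forall>x. poly p (of_nat x) = of_nat (x choose i))"
proof (intro exI conjI allI)
  let ?p = "Polynomial.smult (1 / fact i) (\<Prod>r=0..<i. [:- of_nat r, 1:]) :: real poly"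
  have "degree (\<Prod>r=0..<i. [:- of_nat r, 1:] :: real poly) \<le> (\<Sum>r=0..<i. degree [:- of_nat r, 1:: real:])"
    by (intro degree_prod_sum_le[unfolded o_def]) auto
  then show "degree ?p \<le> i" by simp
  show "poly ?p (of_nat x) = of_nat (x choose i)" for x
    by (simp add: poly_prod binomial_gbinomial gbinomial_prod_rev)
qed

text \<open>Lagrange interpolation expresses the value at \<open>x\<close> of a polynomial of degree less than \<open>card A\<close>
  through its values on \<open>A\<close>. The denominators are products of differences of elements of \<open>A\<close>, so one
  integer \<open>D\<close>, the same for all \<open>x\<close>, clears them. Integrality is what allows the identity to be used
  for exponents.\<close>
lemma binomial_interpolation:
  assumes "finite A"
  obtains D :: nat where "D > 0"
    "\<And>x. \<exists>c :: nat \<Rightarrow> int. \<forall>i<card A.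
       int D * int (x choose i) = (\<Sum>a\<in>A. c a * int (a choose i))"
proof -
  define w where "w a = (\<Prod>b\<in>A-{a}. int a - int b)" for a
  define W where "W = (\<Prod>a\<in>A. w a)"
  have w0: "w a \<noteq> 0" for a
    using assms by (auto simp: w_def prod_zero_iff)
  have "\<exists>c. \<forall>i<card A. int (nat \<bar>W\<bar>) * int (x choose i) = (\<Sum>a\<in>A. c a * int (a choose i))" for x
  proof (intro exI allI impI)
    fix i assume i: "i < card A"
    define l where "l a = (\<Prod>b\<in>A-{a}. int x - int b)" for a
    let ?c = "\<lambda>a. sgn W * (\<Prod>a'\<in>A-{a}. w a') * l a"
    obtain p :: "real poly" where p: "degree p \<le> i" "\<And>x. poly p (of_nat x) = of_nat (x choose i)"
      using ex_binomial_poly by blast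
    have *: "(\<Prod>b\<in>real ` A - {real a}. (real x - b) / (real a - b)) = of_int (l a) / of_int (w a)"
      if "a \<in> A" for a
    proof -
      have "real ` A - {real a} = real ` (A - {a})" by auto
      then show ?thesis
        by (simp add: prod.reindex l_def w_def prod_dividef)
    qed
    have "real (x choose i) =
        (\<Sum>a\<in>real ` A. poly p a * (\<Prod>b\<in>real ` A - {a}. (real x - b) / (a - b)))"
      using lagrange_interpolation[of "real ` A" p "real x"] assms p i
      by (simp add: card_image)
    also have "\<dots> = (\<Sum>a\<in>A. real (a choose i) * (of_int (l a) / of_int (w a)))"
      using * p(2) by (simp add: sum.reindex)
    finally have eq: "real (x choose i) = \<dots>" .
    have W: "W = (\<Prod>a'\<in>A-{a}. w a') * w a" if "a \<in> A" for a
      using assms that by (simp add: W_def prod.remove mult.commute)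
    have "int (nat \<bar>W\<bar>) = sgn W * W"
      using abs_sgn[of W] by (simp add: mult.commute)
    then have "of_int (int (nat \<bar>W\<bar>) * int (x choose i)) = (of_int (sgn W * W) :: real) * real (x choose i)"
      by (simp only: of_int_mult of_int_of_nat_eq)
    also have "\<dots> = (\<Sum>a\<in>A. of_int (sgn W) * of_int W * (real (a choose i) * (of_int (l a) / of_int (w a))))"
      unfolding eq by (simp add: sum_distrib_left)
    also have "\<dots> = (\<Sum>a\<in>A. of_int (?c a * int (a choose i)))"
      using w0 by (intro sum.cong refl) (simp add: W field_simps)
    also have "\<dots> = of_int (\<Sum>a\<in>A. ?c a * int (a choose i))"
      by simp
    finally show "int (nat \<bar>W\<bar>) * int (x choose i) = (\<Sum>a\<in>A. ?c a * int (a choose i))"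
      by (simp only: of_int_eq_iff)
  qed
  moreover have "nat \<bar>W\<bar> > 0"
    using w0 assms by (auto simp: W_def)
  ultimately show thesis using that by blast
qed

text \<open>Written additively this is the Newton form \<open>\<Sum>i<k. (x choose i) * s i\<close> of a polynomial function of
  \<open>x\<close>; here sums of coefficients become products of complex numbers.\<close>
definition binomial_curve :: "nat \<Rightarrow> (nat \<Rightarrow> complex) \<Rightarrow> nat \<Rightarrow> complex" where
  "binomial_curve k s x = (\<Prod>i<k. s i ^ (x choose i))"

lemma binomial_curve_mult:
  "binomial_curve k (\<lambda>i. s i * t i) x = binomial_curve k s x * binomial_curve k t x"
  by (simp add: binomial_curve_def power_mult_distrib prod.distrib)

lemma binomial_curve_power:
  "binomial_curve k (\<lambda>i. s i ^ D) x = binomial_curve k s x ^ D"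
  unfolding binomial_curve_def prod_power_distrib
  by (intro prod.cong refl) (simp add: mult.commute flip: power_mult)

lemma binomial_curve_cong:
  "(\<And>i. i < k \<Longrightarrow> s i = t i) \<Longrightarrow> binomial_curve k s x = binomial_curve k t x"
  by (simp add: binomial_curve_def)

lemma norm_binomial_curve:
  "(\<And>i. i < k \<Longrightarrow> cmod (s i) = 1) \<Longrightarrow> cmod (binomial_curve k s x) = 1"
  by (simp add: binomial_curve_def norm_power flip: prod_norm)

text \<open>The matrix \<open>(x choose i)\<close> with \<open>x, i < k\<close> is unitriangular: once \<open>s j = 1\<close> for all \<open>j < i\<close>, the value
  at \<open>i\<close> is \<open>s i\<close>.\<close>
lemma binomial_curve_initial_trivial:
  assumes "\<And>x. x < k \<Longrightarrow> binomial_curve k s x = 1" "i < k"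
  shows "s i = 1"
  using assms(2)
proof (induction i rule: less_induct)
  case (less i)
  have "s j ^ (i choose j) = (if j = i then s i else 1)" if "j < k" for j
    using less that by (cases j i rule: linorder_cases) (auto simp: binomial_eq_0)
  then have "binomial_curve k s i = (\<Prod>j<k. if j = i then s i else 1)"
    unfolding binomial_curve_def by (intro prod.cong) auto
  then show ?case
    using assms(1)[OF less.prems] less.prems by simp
qed

text \<open>By interpolation the \<open>D\<close>-th power of every value is a product of integer powers of the values on
  \<open>A\<close>. So if the curve is trivial on \<open>A\<close>, the curve with coefficients \<open>s i ^ D\<close> is trivial everywhere,
  and then so are its coefficients. For the finiteness of isotropy groups it matters that \<open>D\<close> does not
  depend on \<open>s\<close>.\<close>
lemma binomial_curve_trivial_torsion:
  assumes "finite A" "card A = k"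
  obtains D :: nat where "D > 0"
    "\<And>s i. \<lbrakk>\<And>i. i < k \<Longrightarrow> s i \<noteq> 0; \<And>a. a \<in> A \<Longrightarrow> binomial_curve k s a = 1; i < k\<rbrakk> \<Longrightarrow> s i ^ D = 1"
proof -
  obtain D where D: "D > 0"
    "\<And>x. \<exists>c :: nat \<Rightarrow> int. \<forall>i<k. int D * int (x choose i) = (\<Sum>a\<in>A. c a * int (a choose i))"
    using binomial_interpolation[OF assms(1)] unfolding assms(2) by metis
  have "s i ^ D = 1"
    if nz: "\<And>i. i < k \<Longrightarrow> s i \<noteq> 0" and A: "\<And>a. a \<in> A \<Longrightarrow> binomial_curve k s a = 1" and "i < k"
    for s i
  proof (rule binomial_curve_initial_trivial[where s = "\<lambda>i. s i ^ D", OF _ \<open>i < k\<close>])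
    fix x
    obtain c :: "nat \<Rightarrow> int" where
      c: "\<And>i. i < k \<Longrightarrow> int D * int (x choose i) = (\<Sum>a\<in>A. c a * int (a choose i))"
      using D(2) by blast
    have powi_sum: "z powi (\<Sum>a\<in>B. g a) = (\<Prod>a\<in>B. z powi g a)"
      if "z \<noteq> 0" "finite B" for z :: complex and g :: "nat \<Rightarrow> int" and B
      using that(2) by induction (use that(1) in \<open>auto simp: power_int_add\<close>)
    have "binomial_curve k (\<lambda>i. s i ^ D) x = (\<Prod>i<k. s i powi (int D * int (x choose i)))"
      unfolding binomial_curve_def by (simp add: power_int_mult)
    also have "\<dots> = (\<Prod>i<k. \<Prod>a\<in>A. s i powi (c a * int (a choose i)))"
      using c powi_sum[OF nz assms(1)] by (intro prod.cong) auto
    also have "\<dots> = (\<Prod>a\<in>A. \<Prod>i<k. s i powi (c a * int (a choose i)))"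
      by (rule prod.swap)
    also have "\<dots> = (\<Prod>a\<in>A. binomial_curve k s a powi c a)"
    proof (intro prod.cong refl)
      fix a
      have "s i powi (c a * int (a choose i)) = (s i ^ (a choose i)) powi c a" for i
        by (simp add: power_int_mult mult.commute[of "c a"])
      then show "(\<Prod>i<k. s i powi (c a * int (a choose i))) = binomial_curve k s a powi c a"
        by (simp add: binomial_curve_def power_int_def prod_power_distrib flip: prod_inversef)
    qed
    also have "\<dots> = 1"
      using A by simp
    finally show "binomial_curve k (\<lambda>i. s i ^ D) x = 1" .
  qed
  with D(1) show thesis using that by blast
qed


section \<open>Subtori in general position\<close>

text \<open>The coordinates in \<open>I\<close> are numbered by \<open>e\<close>, and the subtorus consists of the binomial curves
  with coefficients in the circle, evaluated at these numbers. Values at \<open>0, \<dots>, k - 1\<close> already recover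
  the coefficients, hence injectivity; the inverse is continuous since the torus is compact. If the
  coordinates in \<open>A\<close> are \<open>1\<close>, all coefficients are \<open>D\<close>-th roots of unity, which leaves finitely many
  points.\<close>
lemma ex_generic_subtorus:
  assumes I: "finite I" and k: "k \<le> card I"
  obtains H where "is_subtorus I k H"
    "\<And>A. A \<subseteq> I \<Longrightarrow> card A = k \<Longrightarrow> finite {t \<in> H. \<forall>j\<in>A. t j = 1}"
proof -
  obtain e where e: "bij_betw e I {0..<card I}"
    using ex_bij_betw_finite_nat[OF I] by blast
  define f where "f s = (\<lambda>v\<in>I. binomial_curve k s (e v))" for s
  let ?T = "torus_group {..<k}" and ?H = "f ` carrier (torus_group {..<k})"
  have norm1: "cmod (s i) = 1" if "s \<in> carrier ?T" "i < k" for s i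
    using that by (auto simp: carrier_torus_group PiE_iff)
  have hom: "f \<in> hom ?T (torus_group I)"
  proof (rule homI)
    show "f s \<in> carrier (torus_group I)" if "s \<in> carrier ?T" for s
      using norm_binomial_curve norm1[OF that] by (auto simp: f_def carrier_torus_group)
    show "f (s \<otimes>\<^bsub>?T\<^esub> t) = f s \<otimes>\<^bsub>torus_group I\<^esub> f t" for s t
      unfolding mult_torus_group f_def
      by (intro restrict_ext)
         (simp flip: binomial_curve_mult cong: binomial_curve_cong)
  qed
  interpret f: group_hom ?T "torus_group I" f
    using hom by (simp add: group_hom_def group_hom_axioms_def group_torus_group)
  have "inj_on f (carrier ?T)"
  proof (rule f.inj_on_one_iff[THEN iffD2], intro allI impI)
    fix s assume s: "s \<in> carrier ?T" and "f s = \<one>\<^bsub>torus_group I\<^esub>"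
    then have fs: "binomial_curve k s (e v) = 1" if "v \<in> I" for v
      using that by (auto simp: f_def one_torus_group fun_eq_iff restrict_def split: if_splits)
    have "binomial_curve k s x = 1" if "x < k" for x
    proof -
      have "x \<in> e ` I" using e k that by (auto simp: bij_betw_def)
      then show ?thesis using fs by blast
    qed
    then have "s i = 1" if "i < k" for i
      using binomial_curve_initial_trivial that by blast
    then show "s = \<one>\<^bsub>?T\<^esub>"
      using s by (intro extensionalityI[of _ "{..<k}"]) (auto simp: one_torus_group carrier_torus_group PiE_iff)
  qed
  then have iso: "f \<in> iso ?T ((torus_group I)\<lparr>carrier := ?H\<rparr>)"
    using hom by (auto simp: iso_def hom_def bij_betw_def)
  have cont: "continuous_map (torus_top {..<k}) (subtopology (torus_top I) ?H) f"
  proof -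
    have pr: "continuous_map (torus_top {..<k}) euclidean (\<lambda>s. s i)" if "i < k" for i
      using continuous_map_product_projection[of i "{..<k}" "\<lambda>_. top_of_set (sphere (0::complex) 1)"] that
      unfolding torus_top_def by (simp add: continuous_map_in_subtopology)
    have "continuous_map (torus_top {..<k}) euclidean (\<lambda>s. binomial_curve k s x)" for x
      using pr unfolding binomial_curve_def continuous_map_atin limitin_canonical_iff
      by (auto intro!: tendsto_prod tendsto_power)
    then have "continuous_map (torus_top {..<k}) (torus_top I) f"
      unfolding torus_top_def[of I] continuous_map_componentwise
      using norm_binomial_curve norm1
      by (auto simp: f_def continuous_map_in_subtopology topspace_torus_top Pi_iff)
    then show ?thesis
      by (auto simp: continuous_map_in_subtopology topspace_torus_top)
  qed
  have "homeomorphic_map (torus_top {..<k}) (subtopology (torus_top I) ?H) f"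
  proof (rule continuous_imp_homeomorphic_map[OF cont])
    show "compact_space (torus_top {..<k})"
      unfolding torus_top_def by (simp add: compact_space_product_topology compact_space_subtopology)
    show "Hausdorff_space (subtopology (torus_top I) ?H)"
      unfolding torus_top_def
      by (intro Hausdorff_space_subtopology) (simp add: Hausdorff_space_product_topology Hausdorff_space_subtopology)
    show "f ` topspace (torus_top {..<k}) = topspace (subtopology (torus_top I) ?H)"
      using f.hom_closed by (auto simp: topspace_torus_top)
    show "inj_on f (topspace (torus_top {..<k}))"
      by (simp add: topspace_torus_top) fact
  qed
  then have "is_subtorus I k ?H"
    unfolding is_subtorus_def using f.img_is_subgroup iso by blast
  moreover have "finite {t \<in> ?H. \<forall>j\<in>A. t j = 1}" if A: "A \<subseteq> I" "card A = k" for A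
  proof -
    have inj: "inj_on e A" using e A(1) by (meson bij_betw_def inj_on_subset)
    have "finite (e ` A)" "card (e ` A) = k"
      using A I inj finite_subset by (auto simp: card_image)
    then obtain D where D: "D > 0"
      "\<And>s i. \<lbrakk>\<And>i. i < k \<Longrightarrow> s i \<noteq> 0; \<And>a. a \<in> e ` A \<Longrightarrow> binomial_curve k s a = 1; i < k\<rbrakk>
         \<Longrightarrow> s i ^ D = 1"
      using binomial_curve_trivial_torsion by blast
    let ?R = "{..<k} \<rightarrow>\<^sub>E {z::complex. z ^ D = 1}"
    have "{t \<in> ?H. \<forall>j\<in>A. t j = 1} \<subseteq> f ` ?R"
    proof clarsimp
      fix s assume s: "s \<in> carrier ?T" and A1: "\<forall>j\<in>A. f s j = 1"
      have "s i \<noteq> 0" if "i < k" for i using norm1[OF s that] by auto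
      moreover have "binomial_curve k s a = 1" if "a \<in> e ` A" for a
        using that A1 A(1) by (auto simp: f_def subset_iff)
      ultimately have "s \<in> ?R"
        using D(2) s by (auto simp: carrier_torus_group PiE_iff)
      then show "f s \<in> f ` ?R" by blast
    qed
    moreover have "finite ?R"
      using D(1) by (intro finite_PiE) auto
    ultimately show ?thesis using finite_subset by blast
  qed
  ultimately show thesis using that by blast
qed


section \<open>A bound on the dimension of a subtorus\<close>

lemma torus_mult_apply: "j \<in> I \<Longrightarrow> (s \<otimes>\<^bsub>torus_group I\<^esub> t) j = s j * t j"
  and torus_one_apply: "j \<in> I \<Longrightarrow> \<one>\<^bsub>torus_group I\<^esub> j = 1"
  by (simp_all add: mult_torus_group one_torus_group)

lemma torus_group_pow:
  "t [^]\<^bsub>torus_group I\<^esub> (N::nat) = (\<lambda>i\<in>I. t i ^ N)"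
proof -
  interpret group "torus_group I" by (rule group_torus_group)
  show ?thesis
    by (induction N) (auto simp: one_torus_group mult_torus_group mult.commute)
qed

text \<open>Let \<open>K\<close> be the finite kernel of the projection of the subtorus to the coordinates in \<open>A\<close>. For
  \<open>N = card K + 1\<close>, which is coprime to the order of \<open>K\<close>, the projection is injective on \<open>N\<close>-torsion. A
  torus of dimension \<open>d\<close> has \<open>N ^ d\<close> points of \<open>N\<close>-torsion, so \<open>N ^ k \<le> N ^ card A\<close>.\<close>
lemma subtorus_dim_le_card_constraints:
  assumes sub: "is_subtorus I k H" and A: "finite A" "A \<subseteq> I"
    and fin: "finite {t \<in> H. \<forall>j\<in>A. t j = 1}"
  shows "k \<le> card A"
proof -
  let ?T = "torus_group {..<k}" and ?G = "torus_group I"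
  obtain f where f: "f \<in> iso ?T (?G\<lparr>carrier := H\<rparr>)" and H: "subgroup H ?G"
    using sub by (auto simp: is_subtorus_def)
  interpret T: group ?T by (rule group_torus_group)
  interpret G: group ?G by (rule group_torus_group)
  have inj: "inj_on f (carrier ?T)" and fH: "f ` carrier ?T = H"
    using f by (auto simp: iso_def bij_betw_def)
  have "f \<in> hom ?T ?G"
    using f subgroup.subset[OF H] fH by (auto simp: iso_def hom_def)
  then interpret f: group_hom ?T ?G f
    by unfold_locales
  \<comment> \<open>The kernel is pulled back along \<open>f\<close> to the standard torus, where torsion is easy to count.\<close>
  define K where "K = {s \<in> carrier ?T. \<forall>j\<in>A. f s j = 1}"
  have K: "subgroup K ?T"
  proof (rule T.subgroupI)
    have "\<one>\<^bsub>?T\<^esub> \<in> K"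
      using A(2) T.one_closed f.hom_one by (auto simp: K_def one_torus_group[of I])
    then show "K \<noteq> {}" by blast
    show "inv\<^bsub>?T\<^esub> s \<in> K" if "s \<in> K" for s
    proof -
      have s: "s \<in> carrier ?T" "\<And>j. j \<in> A \<Longrightarrow> f s j = 1" using that by (auto simp: K_def)
      have "f s \<otimes>\<^bsub>?G\<^esub> f (inv\<^bsub>?T\<^esub> s) = \<one>\<^bsub>?G\<^esub>"
        using s(1) by simp
      then have "f s j * f (inv\<^bsub>?T\<^esub> s) j = 1" if "j \<in> I" for j
        using torus_mult_apply[OF that] torus_one_apply[OF that] by metis
      then have "f (inv\<^bsub>?T\<^esub> s) j = 1" if "j \<in> A" for j
        using s(2)[OF that] A(2) that by force
      then show ?thesis using s(1) by (simp add: K_def)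
    qed
  qed (use A(2) in \<open>auto simp: K_def torus_mult_apply subset_iff\<close>)
  have "f ` K \<subseteq> {t \<in> H. \<forall>j\<in>A. t j = 1}"
    using fH by (auto simp: K_def)
  then have "finite K"
    using fin inj finite_subset finite_imageD inj_on_subset unfolding K_def
    by (metis (no_types, lifting) mem_Collect_eq subsetI)
  define N where "N = Suc (card K)"
  have K_tors: "s = \<one>\<^bsub>?T\<^esub>" if "s \<in> K" "s [^]\<^bsub>?T\<^esub> N = \<one>\<^bsub>?T\<^esub>" for s
  proof -
    have s: "s \<in> carrier ?T" using that(1) by (simp add: K_def)
    interpret K: group "?T\<lparr>carrier := K\<rparr>" using K T.subgroup_imp_group by blast
    have "s [^]\<^bsub>?T\<^esub> card K = \<one>\<^bsub>?T\<^esub>"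
      using K.pow_order_eq_1[of s] that(1) by (simp add: order_def T.nat_pow_consistent[symmetric])
    then show ?thesis
      using that(2) s by (simp add: N_def)
  qed
  let ?R = "{z::complex. z ^ N = 1}"
  have N0: "N > 0" by (simp add: N_def)
  have R: "finite ?R" "card ?R = N"
    using card_roots_unity_eq[OF N0] finite_nth_roots[OF N0, of 1] by auto
  have R1: "?R \<subseteq> sphere 0 1"
    using N0 by (auto dest: power_eq_1_iff)
  let ?B = "{..<k} \<rightarrow>\<^sub>E ?R"
  have BC: "?B \<subseteq> carrier ?T"
    unfolding carrier_torus_group using R1 by (rule PiE_mono)
  have BN: "s [^]\<^bsub>?T\<^esub> N = \<one>\<^bsub>?T\<^esub>" if "s \<in> ?B" for s
  proof -
    have "(\<lambda>i\<in>{..<k}. s i ^ N) = (\<lambda>i\<in>{..<k}. 1)"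
      using that by (intro restrict_ext) (auto simp: PiE_iff)
    then show ?thesis by (simp add: torus_group_pow one_torus_group)
  qed
  let ?g = "\<lambda>s. restrict (f s) A"
  have "?g ` ?B \<subseteq> A \<rightarrow>\<^sub>E ?R"
  proof (intro image_subsetI PiE_I)
    fix s j assume s: "s \<in> ?B" and j: "j \<in> A"
    have sc: "s \<in> carrier ?T" using BC s by (rule subsetD)
    have "f s [^]\<^bsub>?G\<^esub> N = \<one>\<^bsub>?G\<^esub>"
      using f.hom_nat_pow[OF sc, of N] BN[OF s] by simp
    then have "(\<lambda>i\<in>I. f s i ^ N) j = (\<lambda>i\<in>I. 1) j"
      using torus_group_pow[where I = I and t = "f s" and N = N] by (simp add: one_torus_group)
    then have "f s j ^ N = 1"
      using j A(2) by (simp add: subset_iff)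
    then show "?g s j \<in> ?R" using j by simp
  qed auto
  moreover have "inj_on ?g ?B"
  proof (rule inj_onI)
    fix s t assume s: "s \<in> ?B" and t: "t \<in> ?B" and eq: "?g s = ?g t"
    have sc: "s \<in> carrier ?T" and tc: "t \<in> carrier ?T" by (rule subsetD[OF BC s], rule subsetD[OF BC t])
    let ?u = "s \<otimes>\<^bsub>?T\<^esub> inv\<^bsub>?T\<^esub> t"
    have uc: "?u \<in> carrier ?T" using sc tc by simp
    have "f ?u \<otimes>\<^bsub>?G\<^esub> f t = f s"
      using sc tc by (simp add: G.m_assoc)
    then have "f ?u j * f t j = f s j" if "j \<in> I" for j
      using torus_mult_apply[OF that] by metis
    moreover have "f s j = f t j" if "j \<in> A" for j
      using fun_cong[OF eq, of j] that by simp
    moreover have "f t j \<noteq> 0" if "j \<in> I" for j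
      using f.hom_closed[OF tc] that by (force simp: carrier_torus_group PiE_iff)
    ultimately have "f ?u j = 1" if "j \<in> A" for j
      using that A(2) by fastforce
    then have "?u \<in> K" using uc by (simp add: K_def)
    moreover have "?u [^]\<^bsub>?T\<^esub> N = \<one>\<^bsub>?T\<^esub>"
    proof -
      have "comm_group ?T"
        by (rule T.group_comm_groupI) (simp add: mult_torus_group mult.commute)
      then interpret T: comm_group ?T .
      show ?thesis
        using sc tc BN[OF s] BN[OF t] by (simp add: T.nat_pow_distrib T.nat_pow_inv)
    qed
    ultimately have "?u = \<one>\<^bsub>?T\<^esub>" using K_tors by blast
    then show "s = t"
      using T.inv_equality[of s "inv\<^bsub>?T\<^esub> t"] sc tc by simp
  qed
  moreover have "finite (A \<rightarrow>\<^sub>E ?R)"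
    using A(1) R(1) by (intro finite_PiE) auto
  ultimately have "card ?B \<le> card (A \<rightarrow>\<^sub>E ?R)"
    using card_inj_on_le by blast
  then have "N ^ k \<le> N ^ card A"
    using A(1) R(2) by (simp add: card_PiE)
  moreover have "N > 1"
    using \<open>finite K\<close> subgroup.one_closed[OF K] by (auto simp: N_def card_gt_0_iff)
  ultimately show ?thesis by simp
qed


section \<open>Vertices of a face\<close>

lemma card_lower_segment:
  assumes "simplicial_poset S leq" "\<sigma> \<in> S"
  shows "card (lower_segment S leq \<sigma>) = 2 ^ rank_of S leq \<sigma>"
  using rank_of_simplicial_poset[OF assms] bij_betw_same_card
  by (fastforce simp: is_simplex_face_poset_def card_Pow)

text \<open>An isomorphism \<open>f\<close> from the segment below \<open>\<sigma>\<close> to the subsets of \<open>{..<rank \<sigma>}\<close> maps the segment below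
  each \<open>j \<le> \<sigma>\<close> onto the subsets of \<open>f j\<close>. Comparing cardinalities gives \<open>rank j = card (f j)\<close>, so the
  vertices below \<open>\<sigma>\<close> correspond to the singletons.\<close>
lemma card_vertices_below:
  assumes sp: "simplicial_poset S leq" and \<sigma>: "\<sigma> \<in> S"
  shows "card {j \<in> vertices S leq. leq j \<sigma>} = rank_of S leq \<sigma>"
proof -
  let ?k = "rank_of S leq \<sigma>" and ?L = "lower_segment S leq \<sigma>"
  obtain f where bij: "bij_betw f ?L (Pow {..<?k})"
    and le: "\<And>x y. x \<in> ?L \<Longrightarrow> y \<in> ?L \<Longrightarrow> leq x y \<longleftrightarrow> f x \<subseteq> f y"
    using rank_of_simplicial_poset[OF assms] unfolding is_simplex_face_poset_def by blast
  have tr: "leq i \<sigma>" if "i \<in> S" "j \<in> S" "leq i j" "leq j \<sigma>" for i j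
    using sp \<sigma> that unfolding simplicial_poset_def by (meson transp_onD)
  have rank: "rank_of S leq j = card (f j)" if j: "j \<in> ?L" for j
  proof -
    have fj: "f j \<subseteq> {..<?k}" using bij j bij_betwE by blast
    have "bij_betw f (lower_segment S leq j) (Pow (f j))"
    proof (rule bij_betw_subset[OF bij])
      show sub: "lower_segment S leq j \<subseteq> ?L"
        using tr j by (auto simp: lower_segment_def)
      have seg: "x \<in> lower_segment S leq j \<longleftrightarrow> f x \<subseteq> f j" if "x \<in> ?L" for x
        using le[OF that j] that by (simp add: lower_segment_def)
      show "f ` lower_segment S leq j = Pow (f j)"
      proof (intro equalityI subsetI)
        fix X assume "X \<in> f ` lower_segment S leq j"
        then show "X \<in> Pow (f j)"
          using seg sub by blast
      next
        fix X assume X: "X \<in> Pow (f j)"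
        then have "X \<in> f ` ?L"
          using bij fj by (auto simp: bij_betw_def)
        then obtain x where "x \<in> ?L" "X = f x" by blast
        then show "X \<in> f ` lower_segment S leq j"
          using X seg by blast
      qed
    qed
    then have "card (lower_segment S leq j) = 2 ^ card (f j)"
      using bij_betw_same_card card_Pow fj finite_subset by (metis finite_lessThan)
    moreover have "j \<in> S" using j by (simp add: lower_segment_def)
    ultimately have "(2::nat) ^ rank_of S leq j = 2 ^ card (f j)"
      using card_lower_segment[OF sp] by metis
    then show ?thesis by simp
  qed
  have "bij_betw f {j \<in> vertices S leq. leq j \<sigma>} {X. X \<subseteq> {..<?k} \<and> card X = 1}"
  proof (rule bij_betw_subset[OF bij])
    show "{j \<in> vertices S leq. leq j \<sigma>} \<subseteq> ?L"
      by (auto simp: vertices_def lower_segment_def)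
    have V: "{j \<in> vertices S leq. leq j \<sigma>} = {j \<in> ?L. card (f j) = 1}"
      using rank by (auto simp: vertices_def lower_segment_def)
    show "f ` {j \<in> vertices S leq. leq j \<sigma>} = {X. X \<subseteq> {..<?k} \<and> card X = 1}"
    proof (intro equalityI subsetI)
      fix X assume X: "X \<in> {X. X \<subseteq> {..<?k} \<and> card X = 1}"
      then have "X \<in> f ` ?L"
        using bij by (auto simp: bij_betw_def)
      then show "X \<in> f ` {j \<in> vertices S leq. leq j \<sigma>}"
        unfolding V using X by blast
    qed (use bij in \<open>auto simp: V bij_betw_def\<close>)
  qed
  then show ?thesis
    using bij_betw_same_card n_subsets[of "{..<?k}" 1] by fastforce
qed


section \<open>Isotropy of the torus action\<close>

text \<open>The inclusions of the diagram preserve coordinates, so the moment-angle complex maps to the polydisc although it need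
  not embed there.\<close>
lemma snd_eq_if_glue_equiv: "(x, y) \<in> glue_equiv S leq \<Longrightarrow> snd x = snd y"
  unfolding glue_equiv_def by (induction rule: rtrancl_induct) (auto simp: glue_def)

lemma torus_action_fixes_iff:
  assumes t: "t \<in> carrier (torus_group (vertices S leq))"
    and x: "\<sigma> \<in> S" "z \<in> disc_block S leq \<sigma>"
  shows "torus_action S leq t (glue_class S leq (\<sigma>, z)) = glue_class S leq (\<sigma>, z) \<longleftrightarrow>
    (\<forall>j\<in>vertices S leq. z j \<noteq> 0 \<longrightarrow> t j = 1)"
proof -
  let ?V = "vertices S leq"
  have "glue_class S leq (block_act S leq t (\<sigma>, z)) = glue_class S leq (\<sigma>, z) \<longleftrightarrow>
      (\<lambda>j\<in>?V. t j * z j) = z" (is "?L \<longleftrightarrow> ?R")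
  proof
    assume ?L
    then have "(\<sigma>, z) \<in> glue_class S leq (block_act S leq t (\<sigma>, z))"
      by (simp add: glue_class_def glue_equiv_def)
    then show ?R
      using snd_eq_if_glue_equiv by (fastforce simp: glue_class_def block_act_def)
  qed (simp add: block_act_def)
  also have "\<dots> \<longleftrightarrow> (\<forall>j\<in>?V. t j * z j = z j)"
    using x(2) by (auto simp: disc_block_def PiE_iff fun_eq_iff extensional_def)
  also have "\<dots> \<longleftrightarrow> (\<forall>j\<in>?V. z j \<noteq> 0 \<longrightarrow> t j = 1)"
    by auto
  finally show ?thesis
    using torus_action_class[OF t] x by simp
qed

text \<open>The isotropy group of a point is largest, within the block of \<open>\<sigma>\<close>, when all coordinates that are
  allowed to vanish do so; it is then the part of \<open>H\<close> in the coordinate torus of the vertices of \<open>\<sigma>\<close>.\<close>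
lemma almost_free_iff:
  assumes H: "H \<subseteq> carrier (torus_group (vertices S leq))"
  shows "almost_free ((torus_group (vertices S leq))\<lparr>carrier := H\<rparr>)
      (topspace (moment_angle_complex S leq)) (torus_action S leq) \<longleftrightarrow>
    (\<forall>\<sigma>\<in>S. finite {t \<in> H. \<forall>j\<in>{j \<in> vertices S leq. \<not> leq j \<sigma>}. t j = 1})"
proof -
  let ?V = "vertices S leq"
  have "almost_free ((torus_group ?V)\<lparr>carrier := H\<rparr>)
      (topspace (moment_angle_complex S leq)) (torus_action S leq) \<longleftrightarrow>
    (\<forall>\<sigma>\<in>S. \<forall>z\<in>disc_block S leq \<sigma>. finite {t \<in> H. \<forall>j\<in>?V. z j \<noteq> 0 \<longrightarrow> t j = 1})"
  proof -
    have "{t \<in> H. torus_action S leq t (glue_class S leq (\<sigma>, z)) = glue_class S leq (\<sigma>, z)} =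
        {t \<in> H. \<forall>j\<in>?V. z j \<noteq> 0 \<longrightarrow> t j = 1}" if "\<sigma> \<in> S" "z \<in> disc_block S leq \<sigma>" for \<sigma> z
      using torus_action_fixes_iff[OF _ that] H by blast
    then show ?thesis
      by (simp add: almost_free_def stabilizer_def topspace_moment_angle_complex)
  qed
  also have "\<dots> \<longleftrightarrow> (\<forall>\<sigma>\<in>S. finite {t \<in> H. \<forall>j\<in>{j \<in> ?V. \<not> leq j \<sigma>}. t j = 1})"
  proof (intro ball_cong refl iffI ballI)
    fix \<sigma> assume all: "\<forall>z\<in>disc_block S leq \<sigma>. finite {t \<in> H. \<forall>j\<in>?V. z j \<noteq> 0 \<longrightarrow> t j = 1}"
    \<comment> \<open>a point of the block with the largest isotropy\<close>
    define z where "z = (\<lambda>j\<in>?V. if leq j \<sigma> then 0 else 1 :: complex)"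
    have "z \<in> disc_block S leq \<sigma>"
      by (auto simp: z_def disc_block_def)
    then have "finite {t \<in> H. \<forall>j\<in>?V. z j \<noteq> 0 \<longrightarrow> t j = 1}"
      using all by blast
    also have "{t \<in> H. \<forall>j\<in>?V. z j \<noteq> 0 \<longrightarrow> t j = 1} = {t \<in> H. \<forall>j\<in>{j \<in> ?V. \<not> leq j \<sigma>}. t j = 1}"
      by (auto simp: z_def)
    finally show "finite {t \<in> H. \<forall>j\<in>{j \<in> ?V. \<not> leq j \<sigma>}. t j = 1}" .
  next
    fix \<sigma> z
    assume fin: "finite {t \<in> H. \<forall>j\<in>{j \<in> ?V. \<not> leq j \<sigma>}. t j = 1}" and z: "z \<in> disc_block S leq \<sigma>"
    have "z j \<noteq> 0" if "j \<in> ?V" "\<not> leq j \<sigma>" for j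
      using z that by (force simp: disc_block_def)
    then have "{t \<in> H. \<forall>j\<in>?V. z j \<noteq> 0 \<longrightarrow> t j = 1} \<subseteq> {t \<in> H. \<forall>j\<in>{j \<in> ?V. \<not> leq j \<sigma>}. t j = 1}"
      by auto
    then show "finite {t \<in> H. \<forall>j\<in>?V. z j \<noteq> 0 \<longrightarrow> t j = 1}"
      using fin finite_subset by blast
  qed
  finally show ?thesis .
qed


section \<open>The toral rank\<close>

theorem corollary4p3:
  fixes S :: "'a set" and leq :: "'a \<Rightarrow> 'a \<Rightarrow> bool" and m n :: nat
  assumes "finite S"
    and "simplicial_poset S leq"
    and "poset_rank S leq = n"
    and "card (vertices S leq) = m"
  shows "int (toral_rank S leq) = int m - int n"
proof -
  let ?V = "vertices S leq"
  define C where "C \<sigma> = {j \<in> ?V. \<not> leq j \<sigma>}" for \<sigma>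
  have finV: "finite ?V" using assms(1) by (simp add: vertices_def)
  have C: "rank_of S leq \<sigma> + card (C \<sigma>) = m" if "\<sigma> \<in> S" for \<sigma>
  proof -
    have "card {j \<in> ?V. leq j \<sigma>} + card (C \<sigma>) = card ({j \<in> ?V. leq j \<sigma>} \<union> C \<sigma>)"
      using finV by (intro card_Un_disjoint[symmetric]) (auto simp: C_def)
    also have "{j \<in> ?V. leq j \<sigma>} \<union> C \<sigma> = ?V" by (auto simp: C_def)
    finally show ?thesis
      using card_vertices_below[OF assms(2) that] assms(4) by simp
  qed
  have "S \<noteq> {}" using assms(2) by (auto simp: simplicial_poset_def)
  then have "n \<in> rank_of S leq ` S"
    using assms(1) unfolding assms(3)[symmetric] poset_rank_def by (intro Max_in) auto
  then obtain \<sigma> where \<sigma>: "\<sigma> \<in> S" "rank_of S leq \<sigma> = n" by blast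
  have rank_le: "rank_of S leq \<tau> \<le> n" if "\<tau> \<in> S" for \<tau>
    using assms(1,3) that by (auto simp: poset_rank_def)
  have nm: "n \<le> m" using C[OF \<sigma>(1)] \<sigma>(2) by simp
  have sub: "H \<subseteq> carrier (torus_group ?V)" if "is_subtorus ?V k H" for k H
    using that subgroup.subset by (auto simp: is_subtorus_def)
  have upper: "toral_rank S leq \<le> m - n"
  proof -
    obtain H where H: "is_subtorus ?V (toral_rank S leq) H"
      and "finite {t \<in> H. \<forall>j\<in>C \<sigma>. t j = 1}"
      using toral_rank_greatest(1)[OF assms(1), of leq] almost_free_iff[OF sub] \<sigma>(1)
      unfolding almost_free_dims_def C_def by blast
    moreover have "finite (C \<sigma>)" "C \<sigma> \<subseteq> ?V"
      using finV by (auto simp: C_def)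
    ultimately have "toral_rank S leq \<le> card (C \<sigma>)"
      using subtorus_dim_le_card_constraints by blast
    then show ?thesis using C[OF \<sigma>(1)] \<sigma>(2) by linarith
  qed
  have lower: "m - n \<le> toral_rank S leq"
  proof -
    obtain H where H: "is_subtorus ?V (m - n) H"
      and gen: "\<And>A. A \<subseteq> ?V \<Longrightarrow> card A = m - n \<Longrightarrow> finite {t \<in> H. \<forall>j\<in>A. t j = 1}"
      using ex_generic_subtorus[OF finV, of "m - n"] assms(4) by auto
    have "finite {t \<in> H. \<forall>j\<in>C \<tau>. t j = 1}" if "\<tau> \<in> S" for \<tau>
    proof -
      have "m - n \<le> card (C \<tau>)" using C[OF that] rank_le[OF that] by linarith
      then obtain A where A: "A \<subseteq> C \<tau>" "card A = m - n"
        using obtain_subset_with_card_n by metis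
      then have "finite {t \<in> H. \<forall>j\<in>A. t j = 1}"
        by (intro gen) (auto simp: C_def)
      then show ?thesis
        by (rule rev_finite_subset) (use A(1) in auto)
    qed
    then have "m - n \<in> almost_free_dims S leq"
      using H almost_free_iff[OF sub[OF H]] unfolding almost_free_dims_def C_def by blast
    then show ?thesis
      using toral_rank_greatest(2)[OF assms(1)] by blast
  qed
  show ?thesis using upper lower nm by simp
qed

end
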